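(* Consider the convex augmentation model $$\min_{u\in\mathbb{C}^n}\ E(u)=\lambda\operatorname{TV}(u)+\sum_{j\in\Gamma}\Big(g_j-\sqrt{|(Au)_j|^2+\delta_j}\Big)^2+\eta\sum_{j\in\Omega}|(Au)_j-(A\hat u)_j|^2+\sum_{j\in\Gamma}\mathbb{I}_{H_j}\big((Au)_j\big),$$ with the data described in the context. Assume that there is a number $\beta>0$ such that $$\beta\|u\|\le\|Au\|_{2,\Gamma}\quad\text{for all }u\in\mathbb{C}^n,\qquad\text{where }\|z\|_{2,\Gamma}=\sqrt{\sum_{j\in\Gamma}|z_j|^2}.$$ Then the minimization problem admits a solution $u^*\in\mathbb{C}^n$.
   Context: $\|\cdot\|$ is the $\ell^2$-norm and $\mathbb{I}_H$ is the indicator function of the set $H$ ($0$ on $H$, $+\infty$ outside). Data: $n=n_1n_2$, $J\ge1$, $\Omega=\{1,\dots,Jn\}$, $\Gamma\subseteq\Omega$; $A:\mathbb{C}^n\to\mathbb{C}^{Jn}$ is a linear operator (masked Fourier measurements being the motivating example); $g_j\in\mathbb{R}$ and $\delta_j>0$ for $j\in\Gamma$; $\lambda,\eta>0$; $\hat u\in\mathbb{C}^n$ is a fixed vector (the initial point) and $\hat z=A\hat u$. Total variation: a vector $u\in\mathbb{C}^n$ is identified with an $n_1\times n_2$ array $U$ via $u_{j+(k-1)n_1}=U_{j,k}$. Put $(\nabla_xU)_{j,k}=U_{j+1,k}-U_{j,k}$ for $1\le j\le n_1-1$ and $0$ for $j=n_1$; $(\nabla_yU)_{j,k}=U_{j,k+1}-U_{j,k}$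 for $1\le k\le n_2-1$ and $0$ for $k=n_2$. Then $\operatorname{TV}(u)=\sum_{j,k}\big(|(\nabla_xU)_{j,k}|+|(\nabla_yU)_{j,k}|\big)$. Sets $H_j$ ($j\in\Gamma$): if $g_j\le0$, $H_j=\mathbb{C}$. If $g_j>0$, let $R_j=\frac{2g_j}{\sqrt3(1+\eta)}$; it is assumed that $|\hat z_j|>R_j$, and $H_j$ is the closed half-plane $H_j=\{\zeta\in\mathbb{C}:\operatorname{Re}(\zeta\,\overline{\hat z_j})/|\hat z_j|\ge R_j+s_j\}$, bounded by the tangent line to the disk $\{|\zeta|\le R_j\}$ at the projection of $\hat z_j$ onto it, shifted by a small amount $s_j$ towards $\hat z_j$, with $0\le s_j\le|\hat z_j|-R_j$. In particular $\hat z_j\in H_j$. *)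

theory Defs
  imports
    Jordan_Normal_Form.VS_Connect
    "HOL-Analysis.L2_Norm"
    "HOL-Library.Extended_Real"
begin

text \<open>All indices are 0-based: coordinates of a vector in \<open>\<complex>\<^sup>m\<close> are numbered \<open>0, \<dots>, m - 1\<close>, and a
  vector \<open>u\<close> of length \<open>n\<^sub>1 n\<^sub>2\<close> is read column by column as an \<open>n\<^sub>1 \<times> n\<^sub>2\<close> array.\<close>

definition array_entry :: "nat \<Rightarrow> complex vec \<Rightarrow> nat \<Rightarrow> nat \<Rightarrow> complex" where
  "array_entry n1 u j k = u $ (j + k * n1)"

definition grad_x :: "nat \<Rightarrow> complex vec \<Rightarrow> nat \<Rightarrow> nat \<Rightarrow> complex" where
  "grad_x n1 u j k =
     (if j + 1 < n1 then array_entry n1 u (j + 1) k - array_entry n1 u j k else 0)"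

definition grad_y :: "nat \<Rightarrow> nat \<Rightarrow> complex vec \<Rightarrow> nat \<Rightarrow> nat \<Rightarrow> complex" where
  "grad_y n1 n2 u j k =
     (if k + 1 < n2 then array_entry n1 u j (k + 1) - array_entry n1 u j k else 0)"

definition TV :: "nat \<Rightarrow> nat \<Rightarrow> complex vec \<Rightarrow> real" where
  "TV n1 n2 u = (\<Sum>j<n1. \<Sum>k<n2. cmod (grad_x n1 u j k) + cmod (grad_y n1 n2 u j k))"

definition norm_on :: "nat set \<Rightarrow> complex vec \<Rightarrow> real" where
  "norm_on I z = L2_set (\<lambda>i. cmod (z $ i)) I"

definition disk_radius :: "real \<Rightarrow> real \<Rightarrow> real" where
  "disk_radius \<eta> c = 2 * c / (sqrt 3 * (1 + \<eta>))"

text \<open>For \<open>c > 0\<close> this is the closed half-plane bounded by the tangent line to the disk of radius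
  \<open>disk_radius \<eta> c\<close> at the projection of \<open>w\<close>, shifted by \<open>s\<close> towards \<open>w\<close>.\<close>

definition constraint_set :: "real \<Rightarrow> real \<Rightarrow> real \<Rightarrow> complex \<Rightarrow> complex set" where
  "constraint_set \<eta> c s w =
     (if c \<le> 0 then UNIV
      else {\<zeta>. Re (\<zeta> * cnj w) / cmod w \<ge> disk_radius \<eta> c + s})"

definition convex_indicator :: "'a set \<Rightarrow> 'a \<Rightarrow> ereal" where
  "convex_indicator H x = (if x \<in> H then 0 else \<infinity>)"

definition energy ::
  "nat \<Rightarrow> nat \<Rightarrow> nat \<Rightarrow> nat set \<Rightarrow> (complex vec \<Rightarrow> complex vec) \<Rightarrow> (nat \<Rightarrow> real) \<Rightarrow> (nat \<Rightarrow> real)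
    \<Rightarrow> (nat \<Rightarrow> real) \<Rightarrow> real \<Rightarrow> real \<Rightarrow> complex vec \<Rightarrow> complex vec \<Rightarrow> ereal" where
  "energy n1 n2 J \<Gamma> A g \<delta> s lam \<eta> u0 u =
     ereal (lam * TV n1 n2 u
        + (\<Sum>j\<in>\<Gamma>. (g j - sqrt ((cmod (A u $ j))\<^sup>2 + \<delta> j))\<^sup>2)
        + \<eta> * (\<Sum>j<J * (n1 * n2). (cmod (A u $ j - A u0 $ j))\<^sup>2))
     + (\<Sum>j\<in>\<Gamma>. convex_indicator (constraint_set \<eta> (g j) (s j) (A u0 $ j)) (A u $ j))"

end

theory Submission
  imports "HOL-Analysis.Function_Topology" "HOL-Analysis.Topology_Euclidean_Space" Defs
begin

unbundle no vec_syntax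
hide_const (open) Finite_Cartesian_Product.vec

text \<open>Vectors of length \<open>n\<close> are parametrised by functions \<open>nat \<Rightarrow> complex\<close>, which carry the product
  topology; the real part of the energy is continuous there and the constraints cut out a closed set.
  On the sublevel set of \<open>u0\<close>, which is feasible, the \<open>\<eta>\<close>-term bounds every measurement
  \<open>A v $ j\<close>, and the lower bound by \<open>\<beta>\<close> then bounds every entry of \<open>v\<close>. So the search can be restricted
  to a compact product of disks.\<close>

text \<open>Allowing every \<open>i\<close> spares the continuity proof for \<open>TV\<close> from
  checking that the array indices stay below \<open>m\<close>.\<close>

lemma continuous_on_vec_index:
  "continuous_on UNIV (\<lambda>x::nat \<Rightarrow> complex. vec m x $ i)"
proof (cases "i < m")
  case True
  then show ?thesis by simp
next
  case False
  \<comment> \<open>an out-of-range entry of \<open>vec m x\<close> is a junk value that does not depend on \<open>x\<close>\<close>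
  then have "vec m x $ i = undef_vec (i - m)" for x :: "nat \<Rightarrow> complex"
    by transfer (simp add: mk_vec_def)
  then show ?thesis by simp
qed

lemma continuous_on_TV: "continuous_on UNIV (\<lambda>x. TV n1 n2 (vec m x))"
  unfolding TV_def
proof (intro continuous_intros)
  show "continuous_on UNIV (\<lambda>x. grad_x n1 (vec m x) j k)" for j k
    by (cases "j + 1 < n1")
      (auto simp: grad_x_def array_entry_def intro!: continuous_intros continuous_on_vec_index)
  show "continuous_on UNIV (\<lambda>x. grad_y n1 n2 (vec m x) j k)" for j k
    by (cases "k + 1 < n2")
      (auto simp: grad_y_def array_entry_def intro!: continuous_intros continuous_on_vec_index)
qed

lemma TV_nonneg: "TV n1 n2 u \<ge> 0"
  unfolding TV_def by (intro sum_nonneg add_nonneg_nonneg) auto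

text \<open>Expanding in the unit vectors turns each measurement into a finite linear combination of
  coordinates, which is visibly continuous in the product topology.\<close>

lemma linear_map_vec_index:
  assumes lin: "linear_map class_ring (module_vec TYPE(complex) m) (module_vec TYPE(complex) p) A"
    and j: "j < p"
  shows "A (vec m x) $ j = (\<Sum>i<m. x i * A (unit_vec m i) $ j)"
proof -
  interpret linear_map class_ring "module_vec TYPE(complex) m" "module_vec TYPE(complex) p" A
    by (rule lin)
  have hom: "A \<in> module_hom class_ring (module_vec TYPE(complex) m) (module_vec TYPE(complex) p)"
    by (rule f_hom)
  have A_carrier: "A v \<in> carrier_vec p" if "v \<in> carrier_vec m" for v
    using hom that by (auto simp: module_hom_def module_vec_simps)
  have A_add: "A (v + w) = A v + A w" if "v \<in> carrier_vec m" "w \<in> carrier_vec m" for v w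
    using hom that by (auto simp: module_hom_def module_vec_simps)
  have A_smult: "A (c \<cdot>\<^sub>v v) = c \<cdot>\<^sub>v A v" if "v \<in> carrier_vec m" for c v
    using hom that by (auto simp: module_hom_def module_vec_simps class_ring_simps)
  \<comment> \<open>Induction on truncations of \<open>x\<close>: raising \<open>k\<close> by one
    adds a single multiple of a unit vector.\<close>
  have "A (vec m (\<lambda>i. if i < k then x i else 0)) $ j = (\<Sum>i<k. x i * A (unit_vec m i) $ j)"
    if "k \<le> m" for k
    using that
  proof (induction k)
    case 0
    \<comment> \<open>Writing zero as a scalar multiple lets homogeneity give that \<open>A\<close>
      vanishes there.\<close>
    have "vec m (\<lambda>i. if i < 0 then x i else 0) = 0 \<cdot>\<^sub>v 0\<^sub>v m" by auto
    with A_smult[of "0\<^sub>v m" 0] A_carrier[of "0\<^sub>v m"] j show ?case by simp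
  next
    case (Suc k)
    have split: "vec m (\<lambda>i. if i < Suc k then x i else 0) =
        vec m (\<lambda>i. if i < k then x i else 0) + x k \<cdot>\<^sub>v unit_vec m k"
      by (rule eq_vecI) (auto simp: less_Suc_eq unit_vec_def)
    show ?case
      using Suc A_carrier[of "unit_vec m k"] A_carrier[of "vec m (\<lambda>i. if i < k then x i else 0)"] j
      by (simp only: split) (simp add: A_add A_smult)
  qed
  from this[of m] have "A (vec m (\<lambda>i. if i < m then x i else 0)) $ j
      = (\<Sum>i<m. x i * A (unit_vec m i) $ j)"
    by simp
  also have "vec m (\<lambda>i. if i < m then x i else 0) = vec m x" by auto
  finally show ?thesis .
qed

lemma continuous_on_linear_map_vec_index:
  assumes "linear_map class_ring (module_vec TYPE(complex) m) (module_vec TYPE(complex) p) A"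
    and "j < p"
  shows "continuous_on UNIV (\<lambda>x. A (vec m x) $ j)"
  by (subst linear_map_vec_index[OF assms]) (intro continuous_intros continuous_on_product_coordinates)

text \<open>Tychonoff's theorem; over the index set \<open>UNIV\<close> extensionality is vacuous,
  so the extensional product is a plain set of functions.\<close>

lemma compact_product_space:
  assumes "\<And>i. compact (S i)"
  shows "compact {x::'a \<Rightarrow> 'b::topological_space. \<forall>i. x i \<in> S i}"
proof -
  have "compactin (product_topology (\<lambda>i::'a. euclidean::'b topology) UNIV) (\<Pi>\<^sub>E i\<in>UNIV. S i)"
    using assms by (simp add: compactin_PiE)
  moreover have "(\<Pi>\<^sub>E i\<in>UNIV. S i) = {x. \<forall>i. x i \<in> S i}"
    by (auto simp: PiE_def Pi_def)
  ultimately show ?thesis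
    by (simp add: euclidean_product_topology)
qed

text \<open>Reading the division as multiplication by a constant inverse keeps the defining function
  continuous even at \<open>w = 0\<close>.\<close>

lemma closed_constraint_set: "closed (constraint_set \<eta> c s w)"
  by (cases "c \<le> 0")
    (auto simp: constraint_set_def divide_inverse intro!: closed_Collect_le continuous_intros)

lemma mem_constraint_set_self:
  assumes "\<eta> > 0" "c > 0 \<Longrightarrow> disk_radius \<eta> c < cmod w" "c > 0 \<Longrightarrow> s \<le> cmod w - disk_radius \<eta> c"
  shows "w \<in> constraint_set \<eta> c s w"
proof (cases "c \<le> 0")
  case False
  \<comment> \<open>A positive radius forces \<open>w\<close> to be nonzero, so the quotient below
    is genuine.\<close>
  then have "disk_radius \<eta> c > 0"
    using assms(1) by (simp add: disk_radius_def)
  then have "cmod w > 0"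
    using False assms(2) by linarith
  moreover have "Re (w * cnj w) = cmod w * cmod w"
    by (simp add: complex_norm_square[symmetric] power2_eq_square del: of_real_mult)
  ultimately have "Re (w * cnj w) / cmod w = cmod w" by simp
  then show ?thesis
    using False assms(3) by (simp add: constraint_set_def)
qed (simp add: constraint_set_def)

lemma sum_convex_indicator:
  assumes "finite I"
  shows "(\<Sum>j\<in>I. convex_indicator (H j) (z j)) = (if \<forall>j\<in>I. z j \<in> H j then 0 else \<infinity>)"
proof (cases "\<forall>j\<in>I. z j \<in> H j")
  case True
  then show ?thesis by (simp add: convex_indicator_def)
next
  case False
  then show ?thesis
    using assms by (auto simp: sum_Pinfty convex_indicator_def)
qed

theorem proposition3p2:
  fixes n n1 n2 J :: nat and \<Gamma> :: "nat set"
    and g \<delta> s :: "nat \<Rightarrow> real" and lam \<eta> :: real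
  assumes "n = n1 * n2" and "J \<ge> 1" and "\<Gamma> \<subseteq> {..<J * n}"
    and "linear_map class_ring (module_vec TYPE(complex) n) (module_vec TYPE(complex) (J * n)) A"
    and "\<And>j. j \<in> \<Gamma> \<Longrightarrow> \<delta> j > 0"
    and "lam > 0" and "\<eta> > 0"
    and "u0 \<in> carrier_vec n"
    and "\<And>j. j \<in> \<Gamma> \<Longrightarrow> g j > 0 \<Longrightarrow> disk_radius \<eta> (g j) < cmod (A u0 $ j)"
    and "\<And>j. j \<in> \<Gamma> \<Longrightarrow> g j > 0 \<Longrightarrow> 0 \<le> s j \<and> s j \<le> cmod (A u0 $ j) - disk_radius \<eta> (g j)"
    and "\<exists>\<beta>>0. \<forall>u\<in>carrier_vec n. \<beta> * norm_on {..<n} u \<le> norm_on \<Gamma> (A u)"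
  shows "\<exists>u\<in>carrier_vec n. \<forall>v\<in>carrier_vec n.
           energy n1 n2 J \<Gamma> A g \<delta> s lam \<eta> u0 u \<le> energy n1 n2 J \<Gamma> A g \<delta> s lam \<eta> u0 v"
proof -
  define F where "F u = lam * TV n1 n2 u
    + (\<Sum>j\<in>\<Gamma>. (g j - sqrt ((cmod (A u $ j))\<^sup>2 + \<delta> j))\<^sup>2)
    + \<eta> * (\<Sum>j<J * n. (cmod (A u $ j - A u0 $ j))\<^sup>2)" for u
  define H where "H j = constraint_set \<eta> (g j) (s j) (A u0 $ j)" for j
  have fin: "finite \<Gamma>"
    using assms(3) finite_subset by blast
  have energy: "energy n1 n2 J \<Gamma> A g \<delta> s lam \<eta> u0 u =
      (if \<forall>j\<in>\<Gamma>. A u $ j \<in> H j then ereal (F u) else \<infinity>)" for u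
    unfolding energy_def F_def H_def assms(1) by (simp add: sum_convex_indicator[OF fin])
  have contA: "continuous_on UNIV (\<lambda>x. A (vec n x) $ j)" if "j < J * n" for j
    by (rule continuous_on_linear_map_vec_index[OF assms(4) that])
  have contF: "continuous_on UNIV (\<lambda>x. F (vec n x))"
    unfolding F_def using assms(3)
    by (intro continuous_intros continuous_on_TV contA) auto
  have feas0: "\<forall>j\<in>\<Gamma>. A u0 $ j \<in> H j"
    unfolding H_def using assms(7,9,10) by (auto intro!: mem_constraint_set_self)
  obtain \<beta> where \<beta>: "\<beta> > 0" "\<And>u. u \<in> carrier_vec n \<Longrightarrow> \<beta> * norm_on {..<n} u \<le> norm_on \<Gamma> (A u)"
    using assms(11) by blast
  \<comment> \<open>\<open>sqrt (F u0 / \<eta>)\<close> bounds the deviation of each measurement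
    from that of \<open>u0\<close>. The sum over \<open>\<Gamma>\<close> dominates the Euclidean
    norm there, and dividing by \<open>\<beta>\<close> carries the bound over to
    \<open>v\<close>.\<close>
  define M where "M = (\<Sum>j\<in>\<Gamma>. cmod (A u0 $ j) + sqrt (F u0 / \<eta>)) / \<beta>"
  have bound: "cmod (v $ i) \<le> M" if v: "v \<in> carrier_vec n" and le: "F v \<le> F u0" and i: "i < n" for v i
  proof -
    have "cmod (A v $ j) \<le> cmod (A u0 $ j) + sqrt (F u0 / \<eta>)" if "j \<in> \<Gamma>" for j
    proof -
      have "(cmod (A v $ j - A u0 $ j))\<^sup>2 \<le> (\<Sum>j<J * n. (cmod (A v $ j - A u0 $ j))\<^sup>2)"
        using assms(3) \<open>j \<in> \<Gamma>\<close> by (intro member_le_sum) auto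
      then have "\<eta> * (cmod (A v $ j - A u0 $ j))\<^sup>2 \<le>
          \<eta> * (\<Sum>j<J * n. (cmod (A v $ j - A u0 $ j))\<^sup>2)"
        using assms(7) by simp
      also have "\<dots> \<le> F v"
        unfolding F_def using assms(6) by (simp add: TV_nonneg sum_nonneg)
      finally have "(cmod (A v $ j - A u0 $ j))\<^sup>2 \<le> F u0 / \<eta>"
        using le assms(7) by (simp add: field_simps)
      then have "cmod (A v $ j - A u0 $ j) \<le> sqrt (F u0 / \<eta>)"
        by (rule real_le_rsqrt)
      moreover have "cmod (A v $ j) \<le> cmod (A u0 $ j) + cmod (A v $ j - A u0 $ j)"
        by (metis add.commute diff_add_cancel norm_triangle_ineq)
      ultimately show ?thesis by simp
    qed
    then have "(\<Sum>j\<in>\<Gamma>. cmod (A v $ j)) \<le> (\<Sum>j\<in>\<Gamma>. cmod (A u0 $ j) + sqrt (F u0 / \<eta>))"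
      by (rule sum_mono)
    also have "\<dots> = \<beta> * M"
      unfolding M_def using \<beta>(1) by simp
    finally have "(\<Sum>j\<in>\<Gamma>. cmod (A v $ j)) \<le> \<beta> * M" .
    moreover have "norm_on \<Gamma> (A v) \<le> (\<Sum>j\<in>\<Gamma>. cmod (A v $ j))"
      unfolding norm_on_def by (rule L2_set_le_sum) simp
    moreover have "cmod (v $ i) \<le> norm_on {..<n} v"
      unfolding norm_on_def using i by (intro member_le_L2_set) auto
    ultimately have "\<beta> * cmod (v $ i) \<le> \<beta> * M"
      using \<beta>(2)[OF v] \<beta>(1) by (smt (verit) mult_left_mono)
    then show ?thesis using \<beta>(1) by simp
  qed
  \<comment> \<open>Coordinates from \<open>n\<close> on are pinned to 0, so that every factor is
    compact; \<open>vec n\<close> ignores them.\<close>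
  define K where "K = {x. \<forall>i. x i \<in> (if i < n then cball 0 M else {0::complex})}"
  define D where "D = (\<Inter>j\<in>\<Gamma>. (\<lambda>x. A (vec n x) $ j) -` H j)"
  have "compact K"
    unfolding K_def by (rule compact_product_space) auto
  moreover have "closed D"
    unfolding D_def H_def using assms(3)
    by (intro closed_INT ballI closed_vimage closed_constraint_set contA) auto
  ultimately have "compact (K \<inter> D)"
    by (rule compact_Int_closed)
  \<comment> \<open>Every feasible vector in the sublevel set of \<open>u0\<close> comes from a
    point of the compact set, by padding with zeros.\<close>
  have rep: "\<exists>x\<in>K \<inter> D. vec n x = v"
    if "v \<in> carrier_vec n" "F v \<le> F u0" "\<forall>j\<in>\<Gamma>. A v $ j \<in> H j" for v
  proof -
    have "vec n (\<lambda>i. if i < n then v $ i else 0) = v"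
      using that(1) by auto
    with that bound[OF that(1,2)] show ?thesis
      by (intro bexI[of _ "\<lambda>i. if i < n then v $ i else 0"]) (auto simp: K_def D_def)
  qed
  have "K \<inter> D \<noteq> {}"
    using rep[OF assms(8) _ feas0] by auto
  then obtain x where x: "x \<in> K \<inter> D" "\<And>y. y \<in> K \<inter> D \<Longrightarrow> F (vec n x) \<le> F (vec n y)"
    using continuous_attains_inf[OF \<open>compact (K \<inter> D)\<close>, of "\<lambda>x. F (vec n x)"] contF
      continuous_on_subset by blast
  \<comment> \<open>Above the level of \<open>u0\<close>, \<open>v\<close> loses to
    \<open>u0\<close>, which is itself represented in \<open>K \<inter> D\<close>.\<close>
  have le: "F (vec n x) \<le> F v" if "v \<in> carrier_vec n" "\<forall>j\<in>\<Gamma>. A v $ j \<in> H j" for v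
  proof (cases "F v \<le> F u0")
    case True
    then show ?thesis using rep[OF that(1) True that(2)] x(2) by auto
  next
    case False
    then show ?thesis using rep[OF assms(8) _ feas0] x(2) by force
  qed
  \<comment> \<open>Feasibility makes the energy of the minimizer equal to the finite value of
    \<open>F\<close>; infeasible competitors have energy \<infinity>.\<close>
  have "\<forall>j\<in>\<Gamma>. A (vec n x) $ j \<in> H j"
    using x(1) by (auto simp: D_def)
  with le show ?thesis
    by (intro bexI[of _ "vec n x"]) (auto simp: energy)
qed

end
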